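(* Let $\mathbb{D}=\{z\in\mathbb{C}:|z|<1\}$. If $f:\mathbb{D}\to\mathbb{D}$ is a harmonic map which is conformal at a point $z\in\mathbb{D}$, then at this point $$\|df_z\|\le \frac{1-|f(z)|^2}{1-|z|^2},$$ with equality if and only if $f$ is a conformal diffeomorphism of the disc $\mathbb{D}$ (onto itself).
   Context: Identify $\mathbb{C}=\mathbb{R}^2$, $z=x+iy$. A map $f:\mathbb{D}\to\mathbb{R}^2$ is harmonic if each of its two real components is a harmonic function; it need not be holomorphic. $f$ is conformal at $z$ if its partial derivatives satisfy $|f_x(z)|=|f_y(z)|$ and $f_x(z)\cdot f_y(z)=0$ (Euclidean norm and inner product); $df_z=0$ is allowed. $\|df_z\|$ is the operator norm of the differential in the Euclidean norms. A conformal diffeomorphism may preserve or reverse orientation, i.e. conformal diffeomorphisms of $\mathbb{D}$ are the holomorphic and the antiholomorphic automorphisms of $\mathbb{D}$. *)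

theory Defs
  imports "HOL-Complex_Analysis.Complex_Analysis"
begin

definition partial_x :: "(complex \<Rightarrow> 'a::real_normed_vector) \<Rightarrow> complex \<Rightarrow> 'a" where
  "partial_x f z = vector_derivative (\<lambda>t. f (Complex t (Im z))) (at (Re z))"

definition partial_y :: "(complex \<Rightarrow> 'a::real_normed_vector) \<Rightarrow> complex \<Rightarrow> 'a" where
  "partial_y f z = vector_derivative (\<lambda>t. f (Complex (Re z) t)) (at (Im z))"

text \<open>The smoothness predicates below are meant for open sets \<open>S\<close>. Differentiability is always
  real (Frechet) differentiability; it also guarantees that the partial derivatives exist, so that
  \<^const>\<open>vector_derivative\<close> does not return an arbitrary value.\<close>

definition C1_on :: "complex set \<Rightarrow> (complex \<Rightarrow> 'a::real_normed_vector) \<Rightarrow> bool" where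
  "C1_on S f \<longleftrightarrow> (\<forall>z\<in>S. f differentiable (at z)) \<and>
     continuous_on S (partial_x f) \<and> continuous_on S (partial_y f)"

definition C2_on :: "complex set \<Rightarrow> (complex \<Rightarrow> 'a::real_normed_vector) \<Rightarrow> bool" where
  "C2_on S f \<longleftrightarrow> C1_on S f \<and> C1_on S (partial_x f) \<and> C1_on S (partial_y f)"

definition harmonic_on :: "complex set \<Rightarrow> (complex \<Rightarrow> real) \<Rightarrow> bool" where
  "harmonic_on S u \<longleftrightarrow> C2_on S u \<and>
     (\<forall>z\<in>S. partial_x (partial_x u) z + partial_y (partial_y u) z = 0)"

definition harmonic_map_on :: "complex set \<Rightarrow> (complex \<Rightarrow> complex) \<Rightarrow> bool" where
  "harmonic_map_on S f \<longleftrightarrow> harmonic_on S (\<lambda>z. Re (f z)) \<and> harmonic_on S (\<lambda>z. Im (f z))"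

text \<open>Here \<open>\<bullet>\<close> is the Euclidean inner product of the real plane; a vanishing differential is
  allowed.\<close>

definition conformal_at :: "(complex \<Rightarrow> complex) \<Rightarrow> complex \<Rightarrow> bool" where
  "conformal_at f z \<longleftrightarrow>
     norm (partial_x f z) = norm (partial_y f z) \<and> partial_x f z \<bullet> partial_y f z = 0"

definition conformal_diffeomorphism ::
    "complex set \<Rightarrow> complex set \<Rightarrow> (complex \<Rightarrow> complex) \<Rightarrow> bool" where
  "conformal_diffeomorphism S T f \<longleftrightarrow>
     bij_betw f S T \<and> C1_on S f \<and> C1_on T (inv_into S f) \<and> (\<forall>z\<in>S. conformal_at f z)"

lemma C1_onI:
  assumes "\<And>z. z \<in> S \<Longrightarrow> f differentiable (at z)"
    and "\<And>z. z \<in> S \<Longrightarrow> partial_x f z = p z" "continuous_on S p"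
    and "\<And>z. z \<in> S \<Longrightarrow> partial_y f z = q z" "continuous_on S q"
  shows "C1_on S f"
  using assms continuous_on_cong[OF refl, of S "partial_x f" p]
    continuous_on_cong[OF refl, of S "partial_y f" q] by (auto simp: C1_on_def)

lemma partial_has_derivative:
  assumes "(f has_derivative L) (at z)"
  shows "partial_x f z = L 1" "partial_y f z = L \<i>"
proof -
  have 1: "((\<lambda>t. Complex t (Im z)) has_derivative (\<lambda>t. t *\<^sub>R 1)) (at (Re z))"
    unfolding Complex_eq by (auto intro!: derivative_eq_intros simp: scaleR_conv_of_real)
  have 2: "((\<lambda>t. Complex (Re z) t) has_derivative (\<lambda>t. t *\<^sub>R \<i>)) (at (Im z))"
    unfolding Complex_eq by (auto intro!: derivative_eq_intros simp: scaleR_conv_of_real)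
  have lin: "linear L" using assms has_derivative_linear by blast
  have "((\<lambda>t. f (Complex t (Im z))) has_derivative (\<lambda>t. L (t *\<^sub>R 1))) (at (Re z))"
    using has_derivative_compose[OF 1, of f L] assms by simp
  then show "partial_x f z = L 1"
    unfolding partial_x_def has_vector_derivative_def linear_cmul[OF lin]
    by (intro vector_derivative_at) (simp add: has_vector_derivative_def)
  have "((\<lambda>t. f (Complex (Re z) t)) has_derivative (\<lambda>t. L (t *\<^sub>R \<i>))) (at (Im z))"
    using has_derivative_compose[OF 2, of f L] assms by simp
  then show "partial_y f z = L \<i>"
    unfolding partial_y_def linear_cmul[OF lin]
    by (intro vector_derivative_at) (simp add: has_vector_derivative_def)
qed

lemma holomorphic_partials:
  assumes "h holomorphic_on S" "open S" "z \<in> S"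
  shows "h differentiable (at z)" "partial_x h z = deriv h z" "partial_y h z = deriv h z * \<i>"
proof -
  have "(h has_derivative (*) (deriv h z)) (at z)"
    using holomorphic_derivI[OF assms] by (simp add: has_field_derivative_def)
  from this partial_has_derivative[OF this] show "h differentiable (at z)"
    "partial_x h z = deriv h z" "partial_y h z = deriv h z * \<i>"
    by (auto simp: differentiable_def)
qed

lemma cnj_partials:
  assumes "h differentiable (at z)"
  shows "(\<lambda>z. cnj (h z)) differentiable (at z)" 
    "partial_x (\<lambda>z. cnj (h z)) z = cnj (partial_x h z)"
    "partial_y (\<lambda>z. cnj (h z)) z = cnj (partial_y h z)"
proof -
  obtain L where L: "(h has_derivative L) (at z)" using assms by (auto simp: differentiable_def)
  have L': "((\<lambda>z. cnj (h z)) has_derivative (\<lambda>w. cnj (L w))) (at z)"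
    using L by (rule has_derivative_cnj)
  show "(\<lambda>z. cnj (h z)) differentiable (at z)" 
    "partial_x (\<lambda>z. cnj (h z)) z = cnj (partial_x h z)"
    "partial_y (\<lambda>z. cnj (h z)) z = cnj (partial_y h z)"
    using L' partial_has_derivative[OF L] partial_has_derivative[OF L']
    by (auto simp: differentiable_def)
qed

lemma partials_cnj:
  assumes "h differentiable (at (cnj z))"
  shows "(\<lambda>z. h (cnj z)) differentiable (at z)" 
    "partial_x (\<lambda>z. h (cnj z)) z = partial_x h (cnj z)"
    "partial_y (\<lambda>z. h (cnj z)) z = - partial_y h (cnj z)"
proof -
  obtain L where L: "(h has_derivative L) (at (cnj z))"
    using assms by (auto simp: differentiable_def)
  have c: "(cnj has_derivative cnj) (at z)"
    by (rule bounded_linear_imp_has_derivative) (rule bounded_linear_cnj)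
  have L': "((\<lambda>z. h (cnj z)) has_derivative (\<lambda>w. L (cnj w))) (at z)"
    by (rule has_derivative_compose[OF c L])
  have "linear L" using L has_derivative_linear by blast
  then have "L (- \<i>) = - L \<i>" by (rule linear_neg)
  then show "(\<lambda>z. h (cnj z)) differentiable (at z)" 
    "partial_x (\<lambda>z. h (cnj z)) z = partial_x h (cnj z)"
    "partial_y (\<lambda>z. h (cnj z)) z = - partial_y h (cnj z)"
    using L' partial_has_derivative[OF L] partial_has_derivative[OF L']
    by (auto simp: differentiable_def)
qed

lemma holomorphic_C1_on:
  assumes "h holomorphic_on S" "open S"
  shows "C1_on S h"
proof -
  have c: "continuous_on S (deriv h)"
    using assms holomorphic_deriv holomorphic_on_imp_continuous_on by blast
  show ?thesis
    by (rule C1_onI[of S h "deriv h" "\<lambda>z. deriv h z * \<i>"])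
       (use c holomorphic_partials[OF assms] in \<open>auto intro!: continuous_intros\<close>)
qed

lemma C1_on_cnj:
  assumes "C1_on S h" shows "C1_on S (\<lambda>z. cnj (h z))"
  by (rule C1_onI[of S _ "\<lambda>z. cnj (partial_x h z)" "\<lambda>z. cnj (partial_y h z)"])
     (use assms cnj_partials[of h] in \<open>auto simp: C1_on_def intro!: continuous_intros\<close>)

lemma C1_on_compose_cnj:
  assumes "C1_on S h" shows "C1_on (cnj ` S) (\<lambda>z. h (cnj z))"
proof -
  have "continuous_on (cnj ` S) (\<lambda>z. partial_x h (cnj z))"
    "continuous_on (cnj ` S) (\<lambda>z. - partial_y h (cnj z))"
    using assms by (auto simp: C1_on_def image_image
      intro!: continuous_intros continuous_on_compose2[of S _ _ cnj])
  moreover have "h differentiable (at (cnj z))" if "z \<in> cnj ` S" for z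
    using assms that by (auto simp: C1_on_def)
  ultimately show ?thesis
    by (intro C1_onI[of _ _ "\<lambda>z. partial_x h (cnj z)" "\<lambda>z. - partial_y h (cnj z)"])
       (simp_all add: partials_cnj)
qed

lemma C1_on_cong:
  assumes "open S" "C1_on S f" "\<And>z. z \<in> S \<Longrightarrow> f z = g z"
  shows "C1_on S g"
proof -
  have "g differentiable (at z) \<and> partial_x g z = partial_x f z \<and> partial_y g z = partial_y f z"
    if z: "z \<in> S" for z
  proof -
    obtain L where L: "(f has_derivative L) (at z)"
      using assms z by (auto simp: C1_on_def differentiable_def)
    have L': "(g has_derivative L) (at z)"
      using has_derivative_transform_within_open[OF L assms(1) z] assms(3) by auto
    show ?thesis using L' partial_has_derivative[OF L] partial_has_derivative[OF L']
      by (auto simp: differentiable_def)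
  qed
  then show ?thesis using assms(2)
    by (intro C1_onI[of _ _ "partial_x f" "partial_y f"]) (auto simp: C1_on_def)
qed

lemma holomorphic_imp_conformal_diffeomorphism:
  assumes S: "open S" and f: "f holomorphic_on S" "bij_betw f S T"
  shows "open T" "conformal_diffeomorphism S T f"
proof -
  have inj: "inj_on f S" and T: "T = f ` S" using f(2) by (auto simp: bij_betw_def)
  obtain g where g: "g holomorphic_on (f ` S)" "\<And>z. z \<in> S \<Longrightarrow> g (f z) = z"
    using holomorphic_has_inverse[OF f(1) S inj] by metis
  show oT: "open T" unfolding T using open_mapping_thm3[OF f(1) S inj] by simp
  have "C1_on T (inv_into S f)"
    by (rule C1_on_cong[OF oT, of g]) (use g inj oT in \<open>auto simp: T intro: holomorphic_C1_on\<close>)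
  moreover have "conformal_at f z" if "z \<in> S" for z
    unfolding conformal_at_def holomorphic_partials[OF f(1) S that]
    by (auto simp: norm_mult inner_complex_def)
  ultimately show "conformal_diffeomorphism S T f"
    using f holomorphic_C1_on[OF f(1) S] by (auto simp: conformal_diffeomorphism_def)
qed

lemma orthogonal_complex:
  fixes a b :: complex
  assumes "norm a = norm b" "a \<bullet> b = 0"
  shows "b = \<i> * a \<or> b = - \<i> * a"
proof -
  have 1: "Re a ^ 2 + Im a ^ 2 = Re b ^ 2 + Im b ^ 2" using assms(1) by (simp add: cmod_def)
  have 2: "Re a * Re b + Im a * Im b = 0" using assms(2) by (simp add: inner_complex_def)
  have "b\<^sup>2 + a\<^sup>2 = 0"
  proof (cases "a = 0")
    case True then show ?thesis using assms(1) by simp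
  next
    case False
    then have p: "Re a ^ 2 + Im a ^ 2 \<noteq> 0" by (metis complex_neq_0 less_irrefl)
    have "(Re a ^ 2 + Im a ^ 2) * (Re b ^ 2 - Im a ^ 2) = 0" using 1 2 by algebra
    then have "Re b ^ 2 - Im a ^ 2 = 0" using p by (metis mult_eq_0_iff)
    then have r: "Re b ^ 2 = Im a ^ 2" by simp
    then have i: "Im b ^ 2 = Re a ^ 2" using 1 by simp
    have "(Re a ^ 2 + Im a ^ 2) * (Re a * Im a + Re b * Im b) = 0" using 1 2 r i by algebra
    then have "Re a * Im a + Re b * Im b = 0" using p by (metis mult_eq_0_iff)
    then have "2 * (Re b * Im b) + 2 * (Re a * Im a) = 0" by linarith
    then show ?thesis using r i
      by (simp add: complex_eq_iff power2_eq_square mult.commute)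
  qed
  then have "(b - \<i> * a) * (b + \<i> * a) = 0" by (simp add: algebra_simps power2_eq_square)
  then show ?thesis by (auto simp: add_eq_0_iff)
qed

text \<open>On a domain the conformal diffeomorphisms are exactly the holomorphic and the
  antiholomorphic bijections; in particular the choice of \<open>C\<^sup>1\<close> rather than
  \<open>C\<^sup>\<infinity>\<close> diffeomorphisms is immaterial.\<close>

lemma conformal_diffeomorphism_iff:
  assumes S: "open S" "connected S"
  shows "conformal_diffeomorphism S T f \<and> open T \<longleftrightarrow>
    bij_betw f S T \<and> (f holomorphic_on S \<or> (\<lambda>z. cnj (f z)) holomorphic_on S)"
proof
  assume "bij_betw f S T \<and> (f holomorphic_on S \<or> (\<lambda>z. cnj (f z)) holomorphic_on S)"
  then consider "bij_betw f S T" "f holomorphic_on S"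
    | "bij_betw f S T" "(\<lambda>z. cnj (f z)) holomorphic_on S" by blast
  then show "conformal_diffeomorphism S T f \<and> open T"
  proof cases
    case 1
    then show ?thesis using holomorphic_imp_conformal_diffeomorphism[OF S(1)] by blast
  next
    case 2
    define h where "h = (\<lambda>z. cnj (f z))"
    have fh: "f = (\<lambda>z. cnj (h z))" by (simp add: h_def)
    have "bij_betw h S (cnj ` T)"
      using 2(1) unfolding h_def bij_betw_def inj_on_def by (auto simp: image_image)
    then have h: "open (cnj ` T)" "conformal_diffeomorphism S (cnj ` T) h"
      using holomorphic_imp_conformal_diffeomorphism[OF S(1)] 2(2) by (auto simp: h_def)
    have "cnj -` (cnj ` T) = T" by (auto simp: image_iff)
    then have oT: "open T" using open_vimage[OF h(1), of cnj] by (simp add: continuous_intros)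
    have "C1_on (cnj ` T) (inv_into S h)" using h(2) by (simp add: conformal_diffeomorphism_def)
    from C1_on_compose_cnj[OF this] have *: "C1_on T (\<lambda>z. inv_into S h (cnj z))"
      by (simp add: image_image)
    have "inv_into S h (cnj z) = inv_into S f z" if "z \<in> T" for z
      unfolding inv_into_def h_def by simp
    then have 1: "C1_on T (inv_into S f)" using C1_on_cong[OF oT *] by blast
    have 3: "C1_on S f" using h(2) C1_on_cnj unfolding fh conformal_diffeomorphism_def by blast
    have "conformal_at f z" if "z \<in> S" for z
    proof -
      have "h differentiable (at z)" "conformal_at h z"
        using h(2) that by (auto simp: conformal_diffeomorphism_def C1_on_def)
      then show ?thesis unfolding conformal_at_def fh
        by (simp add: cnj_partials inner_complex_def)
    qed
    then show ?thesis using 1 3 2(1) oT by (auto simp: conformal_diffeomorphism_def)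
  qed
next
  assume A: "conformal_diffeomorphism S T f \<and> open T"
  then have bij: "bij_betw f S T" and C: "C1_on S f" and Ci: "C1_on T (inv_into S f)"
    and conf: "\<And>z. z \<in> S \<Longrightarrow> conformal_at f z"
    by (auto simp: conformal_diffeomorphism_def)
  let ?a = "partial_x f" and ?b = "partial_y f"
  have D: "(f has_derivative (\<lambda>w. Re w *\<^sub>R ?a z + Im w *\<^sub>R ?b z)) (at z)" if z: "z \<in> S" for z
  proof -
    obtain L where L: "(f has_derivative L) (at z)"
      using C z by (auto simp: C1_on_def differentiable_def)
    have lin: "linear L" using L has_derivative_linear by blast
    have "L w = Re w *\<^sub>R ?a z + Im w *\<^sub>R ?b z" for w
    proof -
      have "w = Re w *\<^sub>R 1 + Im w *\<^sub>R \<i>" by (simp add: complex_eq_iff)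
      then have "L w = L (Re w *\<^sub>R 1 + Im w *\<^sub>R \<i>)" by simp
      then show ?thesis using partial_has_derivative[OF L]
        by (simp add: linear_add[OF lin] linear_cmul[OF lin] del: scaleR_conv_of_real)
    qed
    then have "L = (\<lambda>w. Re w *\<^sub>R ?a z + Im w *\<^sub>R ?b z)" by blast
    then show ?thesis using L by simp
  qed
  have nz: "?a z \<noteq> 0" if z: "z \<in> S" for z
  proof
    assume a0: "?a z = 0"
    then have b0: "?b z = 0" using conf[OF z] by (simp add: conformal_at_def)
    have "f z \<in> T" using bij z by (auto simp: bij_betw_def)
    then obtain G where G: "(inv_into S f has_derivative G) (at (f z))"
      using Ci by (auto simp: C1_on_def differentiable_def)
    have "((\<lambda>w. inv_into S f (f w)) has_derivative (\<lambda>w. G 0)) (at z)"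
      using has_derivative_compose[OF D[OF z] G] a0 b0 by simp
    then have "((\<lambda>w. w) has_derivative (\<lambda>w. G 0)) (at z)"
      by (rule has_derivative_transform_within_open[OF _ S(1) z])
         (use bij in \<open>auto simp: bij_betw_def\<close>)
    then have "(\<lambda>w. G 0) = (\<lambda>w. w)"
      using has_derivative_unique has_derivative_ident by blast
    then have "(0::complex) = 1" by metis
    then show False by simp
  qed
  have ab: "?b z / ?a z \<in> {\<i>, - \<i>}" if z: "z \<in> S" for z
    using orthogonal_complex[of "?a z" "?b z"] conf[OF z] nz[OF z]
    by (auto simp: conformal_at_def field_simps)
  have "continuous_on S (\<lambda>z. ?b z / ?a z)"
    using C nz by (auto simp: C1_on_def intro!: continuous_intros)
  then have "(\<lambda>z. ?b z / ?a z) constant_on S"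
    by (rule continuous_finite_range_constant[OF S(2)])
       (rule finite_subset[of _ "{\<i>, - \<i>}"], use ab in auto)
  then obtain c where c: "\<And>z. z \<in> S \<Longrightarrow> ?b z / ?a z = c" by (auto simp: constant_on_def)
  have "f holomorphic_on S \<or> (\<lambda>z. cnj (f z)) holomorphic_on S"
  proof (cases "c = \<i>")
    case True
    have "(f has_field_derivative ?a z) (at z)" if z: "z \<in> S" for z
    proof -
      have "?b z = \<i> * ?a z" using c[OF z] nz[OF z] True by (simp add: field_simps)
      then have "(\<lambda>w. Re w *\<^sub>R ?a z + Im w *\<^sub>R ?b z) = (*) (?a z)"
        by (auto simp: fun_eq_iff complex_eq_iff algebra_simps)
      then show ?thesis using D[OF z] by (simp add: has_field_derivative_def)
    qed
    then show ?thesis using holomorphic_on_open[OF S(1)] by blast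
  next
    case False
    have "((\<lambda>z. cnj (f z)) has_field_derivative cnj (?a z)) (at z)" if z: "z \<in> S" for z
    proof -
      have "c = - \<i>" using ab[OF z] c[OF z] False by auto
      then have "?b z = - \<i> * ?a z" using c[OF z] nz[OF z] by (simp add: field_simps)
      then have "(\<lambda>w. cnj (Re w *\<^sub>R ?a z + Im w *\<^sub>R ?b z)) = (*) (cnj (?a z))"
        by (auto simp: fun_eq_iff complex_eq_iff algebra_simps)
      then show ?thesis using has_derivative_cnj[OF D[OF z]] by (simp add: has_field_derivative_def)
    qed
    then show ?thesis using holomorphic_on_open[OF S(1)] by blast
  qed
  then show "bij_betw f S T \<and> (f holomorphic_on S \<or> (\<lambda>z. cnj (f z)) holomorphic_on S)"
    using bij by blast
qed

end

theory Submission
  imports Defs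
begin

text \<open>
  On the disc, a harmonic map is \<open>f = p + cnj q\<close> with \<open>p\<close>, \<open>q\<close> holomorphic (lemma
  \<open>harmonic_map_decomposition\<close>), and conformality at \<open>z\<close> says that \<open>p'\<close> or \<open>q'\<close> vanishes at \<open>z\<close>.
  Complex conjugation of \<open>f\<close> exchanges \<open>p\<close> and \<open>q\<close>, so let \<open>q'(z) = 0\<close>; then the norm of the
  differential is \<open>|p'(z)|\<close>. Composing with a disc automorphism that carries \<open>0\<close> to \<open>z\<close> keeps all of
  this and multiplies \<open>p'\<close> by \<open>1 - |z|\<^sup>2\<close> (lemma \<open>conformal_schwarz_pick\<close>), so let \<open>z = 0\<close>.

  At the origin the inequality is a duality estimate. On the unit circle the kernel
  \<open>K(c) = cnj c (1 + t c)\<^sup>2 = cnj c + 2 t + t\<^sup>2 c\<close> reads off three Fourier coefficients of \<open>f\<close>: the mean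
  of \<open>f K\<close> is \<open>p'(0) + 2 t f(0) + t\<^sup>2 cnj (q'(0))\<close>, where the last term is \<open>0\<close>. Being a square up to a
  unimodular factor, \<open>K\<close> has \<open>|K| = |1 + t c|\<^sup>2\<close> with mean \<open>1 + |t|\<^sup>2\<close>. As \<open>|f| \<le> 1\<close>,
  \<open>|p'(0) + 2 t f(0)| \<le> 1 + |t|\<^sup>2\<close>; choosing \<open>t\<close> of modulus \<open>|f(0)|\<close> with the phase that aligns the
  two terms on the left gives \<open>|p'(0)| \<le> 1 - |f(0)|\<^sup>2\<close>.

  Equality forces \<open>f K = k |K|\<close> on the circle for a unimodular constant \<open>k\<close>, that is, \<open>f\<close> has
  the boundary values of the disc automorphism \<open>B(c) = k (c + cnj t) / (1 + t c)\<close>. Since \<open>f\<close> need not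
  extend to the circle, lemma \<open>extremal_deficit\<close> makes this quantitative: what the estimate loses
  bounds the squared distance of \<open>f\<close> from \<open>B\<close> in \<open>L\<^sup>2\<close> of the circle, hence \<open>|p - B|\<^sup>2\<close> and \<open>|q|\<^sup>2\<close>
  inside. Lemma \<open>conformal_schwarz_origin\<close> applies it to \<open>f(r c)\<close> and lets \<open>r\<close> tend to \<open>1\<close>.

  Conversely a holomorphic automorphism and its inverse both satisfy the inequality, and the two
  derivatives have product \<open>1\<close>; so equality holds (lemma \<open>disc_automorphism_norm_deriv\<close>).
\<close>

section \<open>Harmonic maps as holomorphic plus antiholomorphic functions\<close>

lemma has_derivative_partials:
  assumes "f differentiable (at z)"
  shows "(f has_derivative (\<lambda>w. Re w *\<^sub>R partial_x f z + Im w *\<^sub>R partial_y f z)) (at z)"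
proof -
  obtain L where L: "(f has_derivative L) (at z)"
    using assms by (auto simp: differentiable_def)
  have lin: "linear L"
    using L has_derivative_linear by blast
  have "L w = Re w *\<^sub>R partial_x f z + Im w *\<^sub>R partial_y f z" for w
  proof -
    have "L w = L (Re w *\<^sub>R 1 + Im w *\<^sub>R \<i>)"
      by (rule arg_cong[of _ _ L]) (simp add: complex_eq_iff)
    then show ?thesis
      using partial_has_derivative[OF L]
      by (simp add: linear_add[OF lin] linear_cmul[OF lin] del: scaleR_conv_of_real)
  qed
  then have "L = (\<lambda>w. Re w *\<^sub>R partial_x f z + Im w *\<^sub>R partial_y f z)"
    by blast
  then show ?thesis
    using L by simp
qed

lemma DERIV_partials:
  fixes f :: "complex \<Rightarrow> real"
  assumes "f differentiable (at (Complex x y))"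
  shows "((\<lambda>t. f (Complex t y)) has_real_derivative partial_x f (Complex x y)) (at x)"
    and "((\<lambda>t. f (Complex x t)) has_real_derivative partial_y f (Complex x y)) (at y)"
proof -
  have 1: "((\<lambda>t. Complex t y) has_derivative (\<lambda>t. of_real t)) (at x)"
    unfolding Complex_eq by (auto intro!: derivative_eq_intros)
  have 2: "((\<lambda>t. Complex x t) has_derivative (\<lambda>t. \<i> * of_real t)) (at y)"
    unfolding Complex_eq by (auto intro!: derivative_eq_intros)
  note D = has_derivative_partials[OF assms]
  show "((\<lambda>t. f (Complex t y)) has_real_derivative partial_x f (Complex x y)) (at x)"
    using has_derivative_compose[OF 1 D] by (simp add: has_field_derivative_def mult_commute_abs)
  show "((\<lambda>t. f (Complex x t)) has_real_derivative partial_y f (Complex x y)) (at y)"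
    using has_derivative_compose[OF 2 D] by (simp add: has_field_derivative_def mult_commute_abs)
qed

text \<open>
  The mean value theorem in \<open>x\<close>, applied to the difference of two horizontal slices, and then in \<open>y\<close>.
  The second difference is symmetric in the two variables, so exchanging their roles expresses it by
  the other mixed derivative as well.
\<close>

lemma second_difference_mvt:
  fixes G :: "real \<Rightarrow> real \<Rightarrow> real"
  assumes "h > 0"
    and Gx: "\<And>x y. \<lbrakk>a \<le> x; x \<le> a + h; b \<le> y; y \<le> b + h\<rbrakk> \<Longrightarrow>
      ((\<lambda>x. G x y) has_real_derivative Gx x y) (at x)"
    and Gxy: "\<And>x y. \<lbrakk>a \<le> x; x \<le> a + h; b \<le> y; y \<le> b + h\<rbrakk> \<Longrightarrow>
      (Gx x has_real_derivative Gxy x y) (at y)"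
  obtains x y where "a < x" "x < a + h" "b < y" "y < b + h"
    and "G (a + h) (b + h) - G (a + h) b - G a (b + h) + G a b = h * h * Gxy x y"
proof -
  have "\<exists>x>a. x < a + h \<and> (G (a + h) (b + h) - G (a + h) b) - (G a (b + h) - G a b)
      = (a + h - a) * (Gx x (b + h) - Gx x b)"
    using assms(1)
    by (intro MVT2[of a "a + h" "\<lambda>x. G x (b + h) - G x b"]) (auto intro!: DERIV_diff Gx)
  then obtain x where x: "a < x" "x < a + h" and
    1: "G (a + h) (b + h) - G (a + h) b - G a (b + h) + G a b = h * (Gx x (b + h) - Gx x b)"
    by (auto simp: algebra_simps)
  have "\<exists>y>b. y < b + h \<and> Gx x (b + h) - Gx x b = (b + h - b) * Gxy x y"
    using assms(1) x by (intro MVT2) (auto intro!: Gxy)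
  with 1 x that show ?thesis
    by (auto simp: algebra_simps)
qed

text \<open>
  Were the two mixed derivatives different at \<open>z\<close>, continuity would keep their values apart on a
  small square at \<open>z\<close>; but both take the value of the same second difference quotient there.
\<close>

lemma mixed_partials_commute:
  fixes u :: "complex \<Rightarrow> real"
  assumes "open S" "C2_on S u" "z \<in> S"
  shows "partial_y (partial_x u) z = partial_x (partial_y u) z"
proof (rule ccontr)
  let ?A = "partial_y (partial_x u)" and ?B = "partial_x (partial_y u)"
  have d: "u differentiable (at w)" "partial_x u differentiable (at w)"
      "partial_y u differentiable (at w)" if "w \<in> S" for w
    using assms that by (auto simp: C2_on_def C1_on_def)
  have "continuous_on S ?A" "continuous_on S ?B"
    using assms by (auto simp: C2_on_def C1_on_def)
  then have c: "isCont ?A z" "isCont ?B z"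
    using assms by (auto simp: continuous_on_eq_continuous_at)
  assume ne: "?A z \<noteq> ?B z"
  define e where "e = \<bar>?A z - ?B z\<bar> / 2"
  have e: "e > 0"
    using ne by (simp add: e_def)
  obtain d1 where d1: "d1 > 0" "\<And>w. dist w z < d1 \<Longrightarrow> dist (?A w) (?A z) < e"
    using c(1) e unfolding continuous_at_eps_delta by blast
  obtain d2 where d2: "d2 > 0" "\<And>w. dist w z < d2 \<Longrightarrow> dist (?B w) (?B z) < e"
    using c(2) e unfolding continuous_at_eps_delta by blast
  obtain d3 where d3: "d3 > 0" "ball z d3 \<subseteq> S"
    using assms openE by blast
  \<comment> \<open>A square of side \<open>h\<close> at \<open>z\<close> lies in the ball of radius \<open>3 h\<close>, as \<open>2 h < 3 h\<close>.\<close>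
  define h where "h = min d1 (min d2 d3) / 3"
  have h: "h > 0" "3 * h \<le> d1" "3 * h \<le> d2" "3 * h \<le> d3"
    using d1 d2 d3 by (auto simp: h_def)
  have dist: "dist (Complex x y) z < 3 * h"
    if "Re z \<le> x" "x \<le> Re z + h" "Im z \<le> y" "y \<le> Im z + h" for x y
  proof -
    have "dist (Complex x y) z \<le> \<bar>x - Re z\<bar> + \<bar>y - Im z\<bar>"
      using cmod_le[of "Complex x y - z"] by (simp add: dist_norm)
    then show ?thesis
      using that h(1) by linarith
  qed
  have S: "Complex x y \<in> S"
    if "Re z \<le> x" "x \<le> Re z + h" "Im z \<le> y" "y \<le> Im z + h" for x y
    using dist[OF that] h(4) d3(2) by (force simp: dist_commute)
  let ?x = "Re z" and ?y = "Im z"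
  let ?D = "u (Complex (?x + h) (?y + h)) - u (Complex (?x + h) ?y)
    - u (Complex ?x (?y + h)) + u (Complex ?x ?y)"
  obtain x y where 1: "?x < x" "x < ?x + h" "?y < y" "y < ?y + h"
    "?D = h * h * ?A (Complex x y)"
    by (rule second_difference_mvt[OF h(1), of ?x ?y "\<lambda>x y. u (Complex x y)"
          "\<lambda>x y. partial_x u (Complex x y)" "\<lambda>x y. ?A (Complex x y)"])
       (auto intro!: DERIV_partials d S)
  obtain y' x' where 2: "?y < y'" "y' < ?y + h" "?x < x'" "x' < ?x + h"
    "?D = h * h * ?B (Complex x' y')"
    by (rule second_difference_mvt[OF h(1), of ?y ?x "\<lambda>y x. u (Complex x y)"
          "\<lambda>y x. partial_y u (Complex x y)" "\<lambda>y x. ?B (Complex x y)"])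
       (auto intro!: DERIV_partials d S simp: algebra_simps)
  have "?A (Complex x y) = ?B (Complex x' y')"
    using 1(5) 2(5) h(1) by simp
  then have "dist (?A z) (?B z) \<le> dist (?A (Complex x y)) (?A z) + dist (?B (Complex x' y')) (?B z)"
    by (metis dist_triangle3)
  moreover have "dist (?A (Complex x y)) (?A z) < e"
    using d1(2) dist[of x y] 1 h by simp
  moreover have "dist (?B (Complex x' y')) (?B z) < e"
    using d2(2) dist[of x' y'] 2 h by simp
  ultimately show False
    by (simp add: e_def dist_real_def)
qed

text \<open>
  Harmonicity and the symmetry of second derivatives are the Cauchy--Riemann equations for
  \<open>h = u\<^sub>x - \<i> u\<^sub>y\<close>. A primitive of \<open>h\<close>, which convexity provides, has a real part with the same
  differential as \<open>u\<close>.
\<close>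

lemma harmonic_imp_Re_holomorphic:
  assumes S: "open S" "convex S" and u: "harmonic_on S u"
  obtains g where "g holomorphic_on S" "\<And>z. z \<in> S \<Longrightarrow> u z = Re (g z)"
proof -
  have C2: "C2_on S u"
    using u by (simp add: harmonic_on_def)
  have d: "u differentiable (at w)" "partial_x u differentiable (at w)"
      "partial_y u differentiable (at w)" if "w \<in> S" for w
    using C2 that by (auto simp: C2_on_def C1_on_def)
  define h where "h = (\<lambda>z. of_real (partial_x u z) - \<i> * of_real (partial_y u z))"
  have "\<exists>D. (h has_field_derivative D) (at z)" if z: "z \<in> S" for z
  proof -
    let ?a = "partial_x (partial_x u) z" and ?b = "partial_y (partial_x u) z"
    have yx: "partial_x (partial_y u) z = ?b"
      using mixed_partials_commute[OF S(1) C2 z] by simp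
    have yy: "partial_y (partial_y u) z = - ?a"
      using u z unfolding harmonic_on_def by force
    have "(h has_derivative (\<lambda>w. of_real (Re w *\<^sub>R ?a + Im w *\<^sub>R ?b)
        - \<i> * of_real (Re w *\<^sub>R ?b + Im w *\<^sub>R (- ?a)))) (at z)"
      unfolding h_def
      using has_derivative_partials[OF d(2)[OF z]] has_derivative_partials[OF d(3)[OF z]]
      unfolding yx yy
      by (intro has_derivative_diff has_derivative_of_real has_derivative_mult_right)
    moreover have "(\<lambda>w. of_real (Re w *\<^sub>R ?a + Im w *\<^sub>R ?b)
        - \<i> * of_real (Re w *\<^sub>R ?b + Im w *\<^sub>R (- ?a))) = (*) (Complex ?a (- ?b))"
      by (auto simp: fun_eq_iff complex_eq_iff algebra_simps)
    ultimately show ?thesis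
      by (auto simp: has_field_derivative_def)
  qed
  then have "h holomorphic_on S"
    using holomorphic_on_open[OF S(1)] by blast
  then obtain g where g0: "\<And>z. z \<in> S \<Longrightarrow> (g has_field_derivative h z) (at z within S)"
    using holomorphic_convex_primitive'[OF S(2,1)] by blast
  have g: "(g has_field_derivative h z) (at z)" if "z \<in> S" for z
    using g0[OF that] by (simp only: at_within_open[OF that S(1)])
  have "((\<lambda>z. u z - Re (g z)) has_derivative (\<lambda>w. 0)) (at z within S)" if z: "z \<in> S" for z
  proof -
    have "((\<lambda>z. u z - Re (g z)) has_derivative
        (\<lambda>w. (Re w *\<^sub>R partial_x u z + Im w *\<^sub>R partial_y u z) - Re (h z * w))) (at z)"
      using g[OF z] has_derivative_partials[OF d(1)[OF z]]
      unfolding has_field_derivative_def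
      by (intro has_derivative_diff has_derivative_Re)
    moreover have "(\<lambda>w. (Re w *\<^sub>R partial_x u z + Im w *\<^sub>R partial_y u z) - Re (h z * w)) = (\<lambda>w. 0)"
      by (auto simp: h_def algebra_simps)
    ultimately show ?thesis
      using has_derivative_at_withinI by metis
  qed
  from has_derivative_zero_constant[OF S(2) this]
  obtain k where k: "\<And>z. z \<in> S \<Longrightarrow> u z - Re (g z) = k"
    by auto
  have "(\<lambda>z. g z + of_real k) holomorphic_on S"
    using g S(1) by (intro holomorphic_intros) (auto simp: holomorphic_on_open)
  moreover have "u z = Re (g z + of_real k)" if "z \<in> S" for z
    using k[OF that] by simp
  ultimately show ?thesis
    using that by blast
qed

text \<open>
  If \<open>g\<close> and \<open>h\<close> are holomorphic with real parts the components of \<open>f\<close>, then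
  \<open>p = (g + \<i> h)/2\<close> and \<open>q = (g - \<i> h)/2\<close> work. Shifting a constant between the two summands
  normalizes \<open>q\<close> to vanish at a given point.
\<close>

lemma harmonic_map_decomposition:
  assumes S: "open S" "convex S" and f: "harmonic_map_on S f"
  obtains p q where "p holomorphic_on S" "q holomorphic_on S" "q z0 = 0"
    "\<And>z. z \<in> S \<Longrightarrow> f z = p z + cnj (q z)"
proof -
  obtain g where g: "g holomorphic_on S" "\<And>z. z \<in> S \<Longrightarrow> Re (f z) = Re (g z)"
    using f harmonic_imp_Re_holomorphic[OF S] by (auto simp: harmonic_map_on_def)
  obtain h where h: "h holomorphic_on S" "\<And>z. z \<in> S \<Longrightarrow> Im (f z) = Re (h z)"
    using f harmonic_imp_Re_holomorphic[OF S] by (auto simp: harmonic_map_on_def)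
  define p where "p = (\<lambda>z. (g z + \<i> * h z) / 2)"
  define q where "q = (\<lambda>z. (g z - \<i> * h z) / 2)"
  have "(\<lambda>z. p z + cnj (q z0)) holomorphic_on S" "(\<lambda>z. q z - q z0) holomorphic_on S"
    unfolding p_def q_def using g h by (auto intro!: holomorphic_intros)
  moreover have "f z = (p z + cnj (q z0)) + cnj (q z - q z0)" if "z \<in> S" for z
    using g(2)[OF that] h(2)[OF that]
    by (simp add: p_def q_def complex_eq_iff field_simps)
  ultimately show ?thesis
    using that[of "\<lambda>z. p z + cnj (q z0)" "\<lambda>z. q z - q z0"] by simp
qed

section \<open>Means over the unit circle\<close>

text \<open>
  The parameter runs over \<open>{0..1}\<close>, so that an integral over it is already a mean value.
\<close>

definition unit_circle :: "real \<Rightarrow> complex" where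
  "unit_circle = circlepath 0 1"

lemma norm_unit_circle [simp]: "norm (unit_circle s) = 1"
  by (simp add: unit_circle_def circlepath norm_exp_eq_Re)

lemma unit_circle_nz [simp]: "unit_circle s \<noteq> 0"
  by (metis norm_unit_circle norm_zero zero_neq_one)

lemma unit_circle_cnj [simp]: "unit_circle s * cnj (unit_circle s) = 1"
  by (simp add: complex_norm_square[symmetric])

lemma continuous_on_unit_circle [continuous_intros]: "continuous_on A unit_circle"
  unfolding unit_circle_def circlepath by (intro continuous_intros)

lemma circle_mean_Cauchy:
  assumes "g holomorphic_on cball 0 1" "norm w < 1"
  shows "((\<lambda>s. g (unit_circle s) * (unit_circle s / (unit_circle s - w))) has_integral g w) {0..1}"
proof -
  have "((\<lambda>u. g u / (u - w)) has_contour_integral (2 * of_real pi * \<i> * g w)) (circlepath 0 1)"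
    using Cauchy_integral_circlepath_simple[of g 0 1 w] assms by simp
  then have "((\<lambda>s. g (circlepath 0 1 s) / (circlepath 0 1 s - w) *
      (2 * pi * \<i> * exp (2 * of_real pi * \<i> * s))) has_integral (2 * of_real pi * \<i> * g w)) {0..1}"
    by (simp add: has_contour_integral vector_derivative_at[OF has_vector_derivative_circlepath])
  from has_integral_mult_right[OF this, of "1 / (2 * of_real pi * \<i>)"]
  show ?thesis
    by (simp add: unit_circle_def circlepath field_simps)
qed

lemma circle_mean_value:
  assumes "g holomorphic_on cball 0 1"
  shows "((\<lambda>s. g (unit_circle s)) has_integral g 0) {0..1}"
  using circle_mean_Cauchy[OF assms, of 0] by simp

lemma circle_mean_times_coordinate:
  assumes "g holomorphic_on cball 0 1"
  shows "((\<lambda>s. g (unit_circle s) * unit_circle s) has_integral 0) {0..1}"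
  using circle_mean_value[of "\<lambda>z. g z * z"] assms by (simp add: holomorphic_intros)

lemma circle_mean_deriv:
  assumes "g holomorphic_on cball 0 1"
  shows "((\<lambda>s. g (unit_circle s) * cnj (unit_circle s)) has_integral deriv g 0) {0..1}"
proof -
  have "continuous_on (cball 0 1) g" "g holomorphic_on ball 0 1"
    using assms holomorphic_on_imp_continuous_on holomorphic_on_subset[OF _ ball_subset_cball]
    by auto
  from Cauchy_has_contour_integral_higher_derivative_circlepath[OF this, of 0 1]
  have "((\<lambda>u. g u / u\<^sup>2) has_contour_integral (2 * of_real pi * \<i> * deriv g 0)) (circlepath 0 1)"
    by (simp add: power2_eq_square)
  then have "((\<lambda>s. g (circlepath 0 1 s) / (circlepath 0 1 s)\<^sup>2 *
      (2 * pi * \<i> * exp (2 * of_real pi * \<i> * s))) has_integral (2 * of_real pi * \<i> * deriv g 0)) {0..1}"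
    by (simp add: has_contour_integral vector_derivative_at[OF has_vector_derivative_circlepath])
  from has_integral_mult_right[OF this, of "1 / (2 * of_real pi * \<i>)"]
  have "((\<lambda>s. g (unit_circle s) / unit_circle s) has_integral deriv g 0) {0..1}"
    by (simp add: unit_circle_def circlepath field_simps power2_eq_square)
  moreover have "g (unit_circle s) / unit_circle s = g (unit_circle s) * cnj (unit_circle s)" for s
    using unit_circle_cnj[of s] by (simp add: field_simps del: unit_circle_cnj)
  ultimately show ?thesis
    by simp
qed

lemma has_integral_cnjI:
  assumes "(f has_integral I) A"
  shows "((\<lambda>x. cnj (f x)) has_integral cnj I) A"
  using assms has_integral_cnj[of f I A] by (simp add: comp_def)

lemma has_integral_Re:
  assumes "(f has_integral I) A"
  shows "((\<lambda>x. Re (f x)) has_integral Re I) A"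
  using has_integral_linear[OF assms bounded_linear_Re] by (simp add: comp_def)

text \<open>
  The kernel expands to \<open>cnj c + 2 t + t\<^sup>2 c\<close>, so the mean picks out the Fourier coefficients of
  index \<open>1\<close>, \<open>0\<close> and \<open>-1\<close> of the boundary function.
\<close>

lemma circle_mean_test_kernel:
  assumes P: "P holomorphic_on cball 0 1" and Q: "Q holomorphic_on cball 0 1"
  shows "((\<lambda>s. (P (unit_circle s) + cnj (Q (unit_circle s))) * (cnj (unit_circle s) * (1 + t * unit_circle s)\<^sup>2))
    has_integral (deriv P 0 + 2 * t * (P 0 + cnj (Q 0)) + t\<^sup>2 * cnj (deriv Q 0))) {0..1}"
proof -
  let ?c = unit_circle
  note I = circle_mean_deriv[OF P] circle_mean_value[OF P] circle_mean_times_coordinate[OF P]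
    circle_mean_deriv[OF Q, THEN has_integral_cnjI] circle_mean_value[OF Q, THEN has_integral_cnjI]
    circle_mean_times_coordinate[OF Q, THEN has_integral_cnjI]
  have "((\<lambda>s. (P (?c s) * cnj (?c s) + 2 * t * P (?c s) + t\<^sup>2 * (P (?c s) * ?c s)) +
      (cnj (Q (?c s) * ?c s) + 2 * t * cnj (Q (?c s)) + t\<^sup>2 * cnj (Q (?c s) * cnj (?c s))))
    has_integral ((deriv P 0 + 2 * t * P 0 + t\<^sup>2 * 0) + (cnj 0 + 2 * t * cnj (Q 0) + t\<^sup>2 * cnj (deriv Q 0)))) {0..1}"
    by (intro has_integral_add has_integral_mult_right I)
  moreover have "(P (?c s) * cnj (?c s) + 2 * t * P (?c s) + t\<^sup>2 * (P (?c s) * ?c s)) +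
      (cnj (Q (?c s) * ?c s) + 2 * t * cnj (Q (?c s)) + t\<^sup>2 * cnj (Q (?c s) * cnj (?c s)))
    = (P (?c s) + cnj (Q (?c s))) * (cnj (?c s) * (1 + t * ?c s)\<^sup>2)" for s
  proof -
    have "cnj (?c s) * (1 + t * ?c s)\<^sup>2 = cnj (?c s) + 2 * t * (?c s * cnj (?c s)) + t\<^sup>2 * ?c s * (?c s * cnj (?c s))"
      by (simp add: power2_eq_square algebra_simps del: unit_circle_cnj)
    then show ?thesis
      by (simp add: algebra_simps)
  qed
  ultimately show ?thesis
    by (simp add: algebra_simps)
qed

lemma circle_mean_norm_kernel:
  "((\<lambda>s. (norm (1 + t * unit_circle s))\<^sup>2) has_integral (1 + (norm t)\<^sup>2)) {0..1}"
proof -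
  have "((\<lambda>s. unit_circle s) has_integral 0) {0..1}"
    using circle_mean_value[of "\<lambda>z. z"] by (simp add: holomorphic_intros)
  from has_integral_add[OF has_integral_const_real[of "1 + (norm t)\<^sup>2" 0 1]
      has_integral_Re[OF has_integral_mult_right[OF this, of "2 * t"]]]
  have "((\<lambda>s. (1 + (norm t)\<^sup>2) + Re (2 * t * unit_circle s)) has_integral ((1 + (norm t)\<^sup>2) + 0)) {0..1}"
    by simp
  moreover have "(norm (1 + t * unit_circle s))\<^sup>2 = (1 + (norm t)\<^sup>2) + Re (2 * t * unit_circle s)" for s
  proof -
    have "(norm (t * unit_circle s))\<^sup>2 = (norm t)\<^sup>2"
      by (simp add: norm_mult)
    then show ?thesis
      unfolding cmod_power2 by (simp add: power2_eq_square algebra_simps)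
  qed
  ultimately show ?thesis
    by simp
qed

text \<open>
  The normalization of \<open>Q\<close> makes \<open>P\<close> and \<open>cnj Q\<close> orthogonal on the circle: twice the real part of
  \<open>P Q\<close>, the cross term, has mean \<open>0\<close>. Hence the mean squares of \<open>P\<close> and \<open>Q\<close> add up to \<open>I\<close>. Cauchy's
  formula, applied to the squares \<open>P\<^sup>2\<close> and \<open>Q\<^sup>2\<close>, turns mean squares into pointwise bounds.
\<close>

lemma harmonic_pointwise_le_circle_mean:
  assumes P: "P holomorphic_on cball 0 1" and Q: "Q holomorphic_on cball 0 1" "Q 0 = 0"
    and I: "((\<lambda>s. (norm (P (unit_circle s) + cnj (Q (unit_circle s))))\<^sup>2) has_integral I) {0..1}"
    and w: "norm w < 1"
  shows "(norm (P w))\<^sup>2 * (1 - norm w) \<le> I" "(norm (Q w))\<^sup>2 * (1 - norm w) \<le> I"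
proof -
  let ?c = unit_circle
  have int: "(\<lambda>s. (norm (g (?c s)))\<^sup>2) integrable_on {0..1}" if "g holomorphic_on cball 0 1" for g
  proof -
    have "continuous_on {0..1} (\<lambda>s. g (?c s))"
      by (rule continuous_on_compose2[OF holomorphic_on_imp_continuous_on[OF that]])
        (auto intro: continuous_intros)
    then show ?thesis
      by (intro integrable_continuous_real continuous_intros)
  qed
  define IP where "IP = integral {0..1} (\<lambda>s. (norm (P (?c s)))\<^sup>2)"
  define IQ where "IQ = integral {0..1} (\<lambda>s. (norm (Q (?c s)))\<^sup>2)"
  have IP: "((\<lambda>s. (norm (P (?c s)))\<^sup>2) has_integral IP) {0..1}"
    and IQ: "((\<lambda>s. (norm (Q (?c s)))\<^sup>2) has_integral IQ) {0..1}"
    unfolding IP_def IQ_def by (intro integrable_integral int P Q)+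
  have "((\<lambda>s. P (?c s) * Q (?c s)) has_integral (P 0 * Q 0)) {0..1}"
    using P Q by (intro circle_mean_value[of "\<lambda>z. P z * Q z"] holomorphic_intros)
  from has_integral_add[OF has_integral_add[OF IP IQ] has_integral_mult_right[OF has_integral_Re[OF this], of 2]]
  have "((\<lambda>s. (norm (P (?c s)))\<^sup>2 + (norm (Q (?c s)))\<^sup>2 + 2 * Re (P (?c s) * Q (?c s)))
      has_integral (IP + IQ)) {0..1}"
    using Q(2) by simp
  moreover have "(norm a)\<^sup>2 + (norm b)\<^sup>2 + 2 * Re (a * b) = (norm (a + cnj b))\<^sup>2" for a b
    unfolding cmod_power2 by (simp add: power2_eq_square algebra_simps)
  ultimately have "((\<lambda>s. (norm (P (?c s) + cnj (Q (?c s))))\<^sup>2) has_integral (IP + IQ)) {0..1}"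
    by simp
  then have "I = IP + IQ"
    by (rule has_integral_unique[OF I])
  moreover have "IP \<ge> 0" "IQ \<ge> 0"
    using has_integral_nonneg[OF IP] has_integral_nonneg[OF IQ] by auto
  ultimately have le: "IP \<le> I" "IQ \<le> I"
    by auto
  have *: "(norm (g w))\<^sup>2 * (1 - norm w) \<le> J"
    if g: "g holomorphic_on cball 0 1" and J: "((\<lambda>s. (norm (g (?c s)))\<^sup>2) has_integral J) {0..1}" for g J
  proof -
    \<comment> \<open>Squaring \<open>g\<close> before integrating makes its mean square appear without the Cauchy--Schwarz inequality.\<close>
    have C: "((\<lambda>s. (g (?c s))\<^sup>2 * (?c s / (?c s - w))) has_integral (g w)\<^sup>2) {0..1}"
      using g w by (intro circle_mean_Cauchy[of "\<lambda>z. (g z)\<^sup>2"] holomorphic_intros)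
    have bd: "norm ((g (?c s))\<^sup>2 * (?c s / (?c s - w))) \<le> (norm (g (?c s)))\<^sup>2 / (1 - norm w)" for s
    proof -
      have "1 - norm w \<le> norm (?c s - w)"
        using norm_triangle_ineq2[of "?c s" w] by simp
      then show ?thesis
        using w by (auto simp: norm_mult norm_divide norm_power intro!: divide_left_mono mult_pos_pos)
    qed
    have J': "((\<lambda>s. (norm (g (?c s)))\<^sup>2 / (1 - norm w)) has_integral (J / (1 - norm w))) {0..1}"
      by (rule has_integral_divide[OF J])
    have "norm ((g w)\<^sup>2) \<le> J / (1 - norm w)"
      using integral_norm_bound_integral[OF has_integral_integrable[OF C] has_integral_integrable[OF J'] bd]
      unfolding integral_unique[OF C] integral_unique[OF J'] .
    then show ?thesis
      using w by (simp add: norm_power field_simps)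
  qed
  show "(norm (P w))\<^sup>2 * (1 - norm w) \<le> I"
    using *[OF P IP] le by linarith
  show "(norm (Q w))\<^sup>2 * (1 - norm w) \<le> I"
    using *[OF Q(1) IQ] le by linarith
qed

section \<open>The inequality at the origin and its extremal maps\<close>

text \<open>
  The right-hand sides are twice the mean loss in the duality estimate, where \<open>Re (cnj k F K)\<close> is
  replaced by \<open>|K|\<close> for \<open>F = P + cnj Q\<close> and \<open>K = cnj c (1 + t c)\<^sup>2\<close>. On the circle, \<open>|K| cnj B = cnj k K\<close>
  for the automorphism \<open>B = k (c + cnj t) / (1 + t c)\<close>. The elementary inequality
  \<open>|F - B|\<^sup>2 \<le> 2 (1 - Re (F cnj B))\<close> for \<open>|F| \<le> 1 = |B|\<close> thus says that the loss at a point controls the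
  distance of \<open>F\<close> from \<open>B\<close> there.
\<close>

lemma extremal_deficit:
  assumes P: "P holomorphic_on cball 0 1" and Q: "Q holomorphic_on cball 0 1"
    and Q0: "Q 0 = 0" "deriv Q 0 = 0"
    and bound: "\<And>z. norm z = 1 \<Longrightarrow> norm (P z + cnj (Q z)) \<le> 1"
    and k: "norm k = 1" and t: "norm t < 1" and w: "norm w < 1"
  shows "(norm (P w - k * Moebius_function 0 (- cnj t) w))\<^sup>2 * (1 - norm w) * (1 - norm t)\<^sup>2
      \<le> 2 * (1 + (norm t)\<^sup>2 - Re (cnj k * (deriv P 0 + 2 * t * P 0)))"
    and "(norm (Q w))\<^sup>2 * (1 - norm w) * (1 - norm t)\<^sup>2
      \<le> 2 * (1 + (norm t)\<^sup>2 - Re (cnj k * (deriv P 0 + 2 * t * P 0)))"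
proof -
  let ?c = unit_circle
  define B where "B = (\<lambda>z. k * ((z + cnj t) / (1 + t * z)))"
  define F where "F = (\<lambda>z. P z + cnj (Q z))"
  define D where "D = 1 + (norm t)\<^sup>2 - Re (cnj k * (deriv P 0 + 2 * t * P 0))"
  have lower: "1 - norm t \<le> norm (1 + t * z)" if "norm z \<le> 1" for z
  proof -
    have "norm (t * z) \<le> norm t"
      using that by (simp add: norm_mult mult_left_le)
    then show ?thesis
      using norm_triangle_ineq2[of 1 "- (t * z)"] by simp
  qed
  then have nz: "1 + t * z \<noteq> 0" if "norm z \<le> 1" for z
    using that t by fastforce
  have B: "B holomorphic_on cball 0 1"
    unfolding B_def using nz by (auto intro!: holomorphic_intros)
  have PB: "(\<lambda>z. P z - B z) holomorphic_on cball 0 1"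
    using P B by (intro holomorphic_intros)
  have pointwise: "(norm (1 + t * ?c s))\<^sup>2 * (norm (F (?c s) - B (?c s)))\<^sup>2
      \<le> 2 * ((norm (1 + t * ?c s))\<^sup>2 - Re (cnj k * (F (?c s) * (cnj (?c s) * (1 + t * ?c s)\<^sup>2))))" for s
  proof -
    define c where "c = ?c s"
    define v where "v = 1 + t * c"
    have c: "norm c = 1" "c * cnj c = 1"
      by (simp_all add: c_def)
    have v: "v \<noteq> 0"
      using nz[of c] c by (simp add: v_def)
    \<comment> \<open>Thus \<open>B\<close> is unimodular on the circle.\<close>
    have "c + cnj t = c * cnj v"
      using c(2) by (simp add: v_def algebra_simps)
    then have Bc: "B c = k * (c * cnj v / v)"
      by (simp add: B_def v_def)
    then have nB: "norm (B c) = 1"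
      using v k c by (simp add: norm_mult norm_divide)
    have nF: "norm (F c) \<le> 1"
      using bound[of c] c by (simp add: F_def)
    have "(norm (F c - B c))\<^sup>2 = (norm (F c))\<^sup>2 + (norm (B c))\<^sup>2 - 2 * Re (F c * cnj (B c))"
      unfolding cmod_power2 by (simp add: power2_eq_square algebra_simps)
    also have "\<dots> \<le> 2 * (1 - Re (F c * cnj (B c)))"
      using nF nB by (simp add: power_le_one)
    finally have "(norm v)\<^sup>2 * (norm (F c - B c))\<^sup>2 \<le> (norm v)\<^sup>2 * (2 * (1 - Re (F c * cnj (B c))))"
      by (rule mult_left_mono) simp
    also have "\<dots> = 2 * ((norm v)\<^sup>2 - Re (of_real ((norm v)\<^sup>2) * (F c * cnj (B c))))"
      by (simp add: algebra_simps)
    also have "of_real ((norm v)\<^sup>2) * (F c * cnj (B c)) = cnj k * (F c * (cnj c * v\<^sup>2))"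
      unfolding complex_norm_square Bc using v by (simp add: field_simps power2_eq_square)
    finally show ?thesis
      by (simp add: c_def v_def)
  qed
  have "((\<lambda>s. F (?c s) * (cnj (?c s) * (1 + t * ?c s)\<^sup>2)) has_integral (deriv P 0 + 2 * t * P 0)) {0..1}"
    using circle_mean_test_kernel[OF P Q, of t] Q0 by (simp add: F_def)
  from has_integral_mult_right[OF has_integral_diff[OF circle_mean_norm_kernel[of t]
      has_integral_Re[OF has_integral_mult_right[OF this, of "cnj k"]]], of 2]
  have upper: "((\<lambda>s. 2 * ((norm (1 + t * ?c s))\<^sup>2
      - Re (cnj k * (F (?c s) * (cnj (?c s) * (1 + t * ?c s)\<^sup>2))))) has_integral (2 * D)) {0..1}"
    unfolding D_def .
  have "continuous_on {0..1} (\<lambda>s. P (?c s))" "continuous_on {0..1} (\<lambda>s. Q (?c s))"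
      "continuous_on {0..1} (\<lambda>s. B (?c s))"
    using P Q B by (auto intro!: continuous_on_compose2[of "cball 0 1" _ "{0..1}" ?c]
        holomorphic_on_imp_continuous_on continuous_intros)
  then have "continuous_on {0..1} (\<lambda>s. (norm ((P (?c s) - B (?c s)) + cnj (Q (?c s))))\<^sup>2)"
    by (intro continuous_intros)
  then obtain I where I: "((\<lambda>s. (norm ((P (?c s) - B (?c s)) + cnj (Q (?c s))))\<^sup>2) has_integral I) {0..1}"
    using integrable_continuous_real by blast
  have "(1 - norm t)\<^sup>2 * I \<le> 2 * D"
  proof (rule has_integral_le[OF has_integral_mult_right[OF I] upper])
    fix s :: real
    have "(1 - norm t)\<^sup>2 \<le> (norm (1 + t * ?c s))\<^sup>2"
      using lower[of "?c s"] t by (intro power_mono) auto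
    then have "(1 - norm t)\<^sup>2 * (norm (F (?c s) - B (?c s)))\<^sup>2
        \<le> (norm (1 + t * ?c s))\<^sup>2 * (norm (F (?c s) - B (?c s)))\<^sup>2"
      by (rule mult_right_mono) simp
    with pointwise[of s]
    show "(1 - norm t)\<^sup>2 * (norm ((P (?c s) - B (?c s)) + cnj (Q (?c s))))\<^sup>2
        \<le> 2 * ((norm (1 + t * ?c s))\<^sup>2
          - Re (cnj k * (F (?c s) * (cnj (?c s) * (1 + t * ?c s)\<^sup>2))))"
      by (simp add: F_def algebra_simps)
  qed
  then have *: "x * (1 - norm t)\<^sup>2 \<le> 2 * D" if "x \<le> I" for x
    using mult_right_mono[OF that, of "(1 - norm t)\<^sup>2"] by (simp add: mult.commute)
  have "B w = k * Moebius_function 0 (- cnj t) w"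
    by (simp add: B_def Moebius_function_simple)
  then show "(norm (P w - k * Moebius_function 0 (- cnj t) w))\<^sup>2 * (1 - norm w) * (1 - norm t)\<^sup>2
      \<le> 2 * (1 + (norm t)\<^sup>2 - Re (cnj k * (deriv P 0 + 2 * t * P 0)))"
    using *[OF harmonic_pointwise_le_circle_mean(1)[OF PB Q Q0(1) I w]] by (simp add: D_def)
  show "(norm (Q w))\<^sup>2 * (1 - norm w) * (1 - norm t)\<^sup>2
      \<le> 2 * (1 + (norm t)\<^sup>2 - Re (cnj k * (deriv P 0 + 2 * t * P 0)))"
    using *[OF harmonic_pointwise_le_circle_mean(2)[OF PB Q Q0(1) I w]] by (simp add: D_def)
qed

lemma holomorphic_dilation:
  fixes p :: "complex \<Rightarrow> complex"
  assumes p: "p holomorphic_on ball 0 1" and r: "0 \<le> r" "r < 1"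
  shows "(\<lambda>z. p (of_real r * z)) holomorphic_on cball 0 1"
    and "deriv (\<lambda>z. p (of_real r * z)) 0 = of_real r * deriv p 0"
proof -
  have sub: "(\<lambda>z. complex_of_real r * z) ` cball 0 1 \<subseteq> ball 0 1"
  proof
    fix y assume "y \<in> (\<lambda>z. complex_of_real r * z) ` cball 0 1"
    then obtain z where z: "y = of_real r * z" "z \<in> cball 0 1"
      by blast
    then have "norm y \<le> r"
      using r by (simp add: norm_mult mult_left_le)
    then show "y \<in> ball 0 1"
      using r by simp
  qed
  show "(\<lambda>z. p (of_real r * z)) holomorphic_on cball 0 1"
    using holomorphic_on_compose_gen[OF _ p sub] by (simp add: comp_def holomorphic_intros)
  have "(p has_field_derivative deriv p 0) (at (of_real r * 0))"
    using holomorphic_derivI[OF p, of 0] by simp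
  from DERIV_chain2[OF this DERIV_cmult_Id]
  show "deriv (\<lambda>z. p (of_real r * z)) 0 = of_real r * deriv p 0"
    using DERIV_imp_deriv by (metis mult.commute)
qed

text \<open>
  For a unimodular \<open>k\<close> with \<open>p'(0) = k |p'(0)|\<close>, \<open>a = p(0)\<close> and \<open>t = k cnj a\<close>, the loss in the duality estimate for
  the dilated map \<open>f(r c)\<close> is \<open>1 - |a|\<^sup>2 - r |p'(0)|\<close>. It is nonnegative for every \<open>r < 1\<close>, which is the
  inequality; in the case of equality it tends to \<open>0\<close> as \<open>r\<close> tends to \<open>1\<close>, and \<open>extremal_deficit\<close>
  identifies \<open>p\<close> and \<open>q\<close>.
\<close>

lemma conformal_schwarz_origin:
  assumes p: "p holomorphic_on ball 0 1" and q: "q holomorphic_on ball 0 1"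
    and q0: "q 0 = 0" "deriv q 0 = 0"
    and bound: "\<And>z. norm z < 1 \<Longrightarrow> norm (p z + cnj (q z)) < 1"
  shows "norm (deriv p 0) \<le> 1 - (norm (p 0))\<^sup>2"
    and "norm (deriv p 0) = 1 - (norm (p 0))\<^sup>2 \<Longrightarrow>
      \<exists>k b. norm k = 1 \<and> norm b < 1 \<and>
        (\<forall>w. norm w < 1 \<longrightarrow> q w = 0 \<and> p w = k * Moebius_function 0 b w)"
proof -
  define a where "a = p 0"
  have a: "norm a < 1"
    using bound[of 0] q0 by (simp add: a_def)
  obtain k where k: "norm k = 1" "cnj k * deriv p 0 = of_real (norm (deriv p 0))"
  proof (cases "deriv p 0 = 0")
    case True
    then show ?thesis using that[of 1] by simp
  next
    case False
    show ?thesis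
    proof (rule that[of "sgn (deriv p 0)"])
      show "cnj (sgn (deriv p 0)) * deriv p 0 = of_real (norm (deriv p 0))"
        using False complex_norm_square[of "deriv p 0"]
        by (simp add: sgn_eq field_simps power2_eq_square)
    qed (use False in \<open>simp add: norm_sgn\<close>)
  qed
  define t where "t = k * cnj a"
  have t: "norm t = norm a"
    using k by (simp add: t_def norm_mult)
  have kta: "Re (cnj k * (of_real r * deriv p 0 + 2 * t * p 0)) = r * norm (deriv p 0) + 2 * (norm a)\<^sup>2" for r
  proof -
    have kk: "k * cnj k = 1"
      using k(1) complex_norm_square[of k] by simp
    have "cnj k * (of_real r * deriv p 0 + 2 * t * p 0)
        = of_real r * (cnj k * deriv p 0) + 2 * (k * cnj k) * (a * cnj a)"
      by (simp add: t_def a_def algebra_simps)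
    also have "\<dots> = of_real (r * norm (deriv p 0) + 2 * (norm a)\<^sup>2)"
      using kk complex_norm_square[of a] by (simp add: k(2))
    finally show ?thesis
      by (metis Re_complex_of_real)
  qed
  have main: "(norm (p (of_real r * w) - k * Moebius_function 0 (- cnj t) w))\<^sup>2 * (1 - norm w) * (1 - norm t)\<^sup>2
        \<le> 2 * (1 - (norm a)\<^sup>2 - r * norm (deriv p 0))"
      "(norm (q (of_real r * w)))\<^sup>2 * (1 - norm w) * (1 - norm t)\<^sup>2
        \<le> 2 * (1 - (norm a)\<^sup>2 - r * norm (deriv p 0))"
    if r: "0 \<le> r" "r < 1" and w: "norm w < 1" for r w
  proof -
    have b: "norm (p (of_real r * z) + cnj (q (of_real r * z))) \<le> 1" if "norm z = 1" for z
      using bound[of "of_real r * z"] that r by (simp add: norm_mult)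
    have "norm t < 1"
      using a t by simp
    note E = extremal_deficit[OF holomorphic_dilation(1)[OF p r] holomorphic_dilation(1)[OF q r] _ _ b k(1) this w]
    show "(norm (p (of_real r * w) - k * Moebius_function 0 (- cnj t) w))\<^sup>2 * (1 - norm w) * (1 - norm t)\<^sup>2
        \<le> 2 * (1 - (norm a)\<^sup>2 - r * norm (deriv p 0))"
      using E(1) kta[of r] by (simp add: holomorphic_dilation(2)[OF p r] holomorphic_dilation(2)[OF q r] q0 t)
    show "(norm (q (of_real r * w)))\<^sup>2 * (1 - norm w) * (1 - norm t)\<^sup>2
        \<le> 2 * (1 - (norm a)\<^sup>2 - r * norm (deriv p 0))"
      using E(2) kta[of r] by (simp add: holomorphic_dilation(2)[OF p r] holomorphic_dilation(2)[OF q r] q0 t)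
  qed
  have lim: "((\<lambda>r. 2 * (1 - (norm a)\<^sup>2 - r * norm (deriv p 0)))
      \<longlongrightarrow> 2 * (1 - (norm a)\<^sup>2 - 1 * norm (deriv p 0))) (at_left 1)"
    by (intro tendsto_intros)
  have ev: "eventually (\<lambda>r::real. 0 \<le> r \<and> r < 1) (at_left 1)"
    by (rule eventually_at_leftI[of 0]) auto
  have "0 \<le> 2 * (1 - (norm a)\<^sup>2 - 1 * norm (deriv p 0))"
  proof (rule tendsto_lowerbound[OF lim])
    show "eventually (\<lambda>r. 0 \<le> 2 * (1 - (norm a)\<^sup>2 - r * norm (deriv p 0))) (at_left 1)"
      using ev
    proof eventually_elim
      case (elim r)
      then show ?case
        using main(2)[of r 0] by (simp add: q0)
    qed
  qed simp
  then show "norm (deriv p 0) \<le> 1 - (norm (p 0))\<^sup>2"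
    by (simp add: a_def)
  assume eq: "norm (deriv p 0) = 1 - (norm (p 0))\<^sup>2"
  \<comment> \<open>With equality, the bounds in \<open>main\<close> become \<open>0\<close> in the limit.\<close>
  have zero: "x = 0"
    if g: "(g \<longlongrightarrow> x) (at_left 1)" and w: "norm w < 1"
      and le: "\<And>r. \<lbrakk>0 \<le> r; r < 1\<rbrakk> \<Longrightarrow> (norm (g r))\<^sup>2 * (1 - norm w) * (1 - norm t)\<^sup>2
        \<le> 2 * (1 - (norm a)\<^sup>2 - r * norm (deriv p 0))"
    for g :: "real \<Rightarrow> complex" and x w :: complex
  proof -
    have "(norm x)\<^sup>2 * (1 - norm w) * (1 - norm t)\<^sup>2 \<le> 2 * (1 - (norm a)\<^sup>2 - 1 * norm (deriv p 0))"
    proof (rule tendsto_le[OF _ lim])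
      show "((\<lambda>r. (norm (g r))\<^sup>2 * (1 - norm w) * (1 - norm t)\<^sup>2)
          \<longlongrightarrow> (norm x)\<^sup>2 * (1 - norm w) * (1 - norm t)\<^sup>2) (at_left 1)"
        by (intro tendsto_intros g)
      show "eventually (\<lambda>r. (norm (g r))\<^sup>2 * (1 - norm w) * (1 - norm t)\<^sup>2
          \<le> 2 * (1 - (norm a)\<^sup>2 - r * norm (deriv p 0))) (at_left 1)"
        using ev by eventually_elim (use le in blast)
    qed simp
    then have "(norm x)\<^sup>2 * ((1 - norm w) * (1 - norm t)\<^sup>2) \<le> 0"
      using eq by (simp add: a_def mult.assoc)
    moreover have "(1 - norm w) * (1 - norm t)\<^sup>2 > 0"
      using w a t by simp
    ultimately show ?thesis
      by (simp add: mult_le_0_iff not_le[symmetric])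
  qed
  have lim_dilate: "((\<lambda>r. g (of_real r * w)) \<longlongrightarrow> g w) (at_left 1)"
    if g: "g holomorphic_on ball 0 1" and w: "norm w < 1" for g w
  proof -
    have "isCont g w"
      using holomorphic_on_imp_continuous_on[OF g] w
      by (simp add: continuous_on_eq_continuous_at)
    moreover have "((\<lambda>r. of_real r * w) \<longlongrightarrow> of_real 1 * w) (at_left 1)"
      by (intro tendsto_intros)
    ultimately show ?thesis
      using isCont_tendsto_compose by force
  qed
  have "q w = 0 \<and> p w = k * Moebius_function 0 (- cnj t) w" if w: "norm w < 1" for w
  proof
    show "q w = 0"
      by (rule zero[OF lim_dilate[OF q w] w]) (rule main(2)[OF _ _ w])
    have "((\<lambda>r. p (of_real r * w) - k * Moebius_function 0 (- cnj t) w)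
        \<longlongrightarrow> p w - k * Moebius_function 0 (- cnj t) w) (at_left 1)"
      by (intro tendsto_intros lim_dilate[OF p w])
    then have "p w - k * Moebius_function 0 (- cnj t) w = 0"
      by (rule zero[OF _ w]) (rule main(1)[OF _ _ w])
    then show "p w = k * Moebius_function 0 (- cnj t) w"
      by simp
  qed
  then show "\<exists>k b. norm k = 1 \<and> norm b < 1 \<and>
      (\<forall>w. norm w < 1 \<longrightarrow> q w = 0 \<and> p w = k * Moebius_function 0 b w)"
    using k(1) a t by (intro exI[of _ k] exI[of _ "- cnj t"]) simp
qed

section \<open>Moving the point by a disc automorphism\<close>

lemma bij_betw_Moebius:
  assumes "norm k = 1" "norm b < 1"
  shows "bij_betw (\<lambda>w. k * Moebius_function 0 b w) (ball 0 1) (ball 0 1)"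
proof -
  have k: "k * cnj k = 1" "cnj k * k = 1"
    using assms complex_norm_square[of k] by (simp_all add: mult.commute)
  show ?thesis
  proof (rule bij_betw_byWitness[where f' = "\<lambda>w. Moebius_function 0 (- b) (cnj k * w)"])
    show "\<forall>w\<in>ball 0 1. Moebius_function 0 (- b) (cnj k * (k * Moebius_function 0 b w)) = w"
      using assms k by (simp add: mult.assoc[symmetric] Moebius_function_compose)
    show "\<forall>w\<in>ball 0 1. k * Moebius_function 0 b (Moebius_function 0 (- b) (cnj k * w)) = w"
      using assms k
      by (simp add: mult.assoc[symmetric] Moebius_function_compose norm_mult)
    show "(\<lambda>w. k * Moebius_function 0 b w) ` ball 0 1 \<subseteq> ball 0 1"
      using assms by (auto simp: norm_mult Moebius_function_norm_lt_1)
    show "(\<lambda>w. Moebius_function 0 (- b) (cnj k * w)) ` ball 0 1 \<subseteq> ball 0 1"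
      using assms by (auto simp: norm_mult Moebius_function_norm_lt_1)
  qed
qed

lemma DERIV_Moebius_at_zero:
  "(Moebius_function 0 (- z) has_field_derivative of_real (1 - (norm z)\<^sup>2)) (at 0)"
proof -
  have "((\<lambda>w. (w + z) / (1 + cnj z * w)) has_field_derivative (1 - z * cnj z)) (at 0)"
    by (auto intro!: derivative_eq_intros)
  then show ?thesis
    unfolding of_real_diff of_real_1 complex_norm_square by (simp add: Moebius_function_simple[abs_def])
qed

text \<open>
  Composition with the automorphism \<open>M\<close> that carries \<open>0\<close> to \<open>z\<close> reduces this to the origin, since
  \<open>p\<close> and \<open>q\<close> stay holomorphic and \<open>M'(0) = 1 - |z|\<^sup>2\<close>.
\<close>

lemma conformal_schwarz_pick:
  assumes p: "p holomorphic_on ball 0 1" and q: "q holomorphic_on ball 0 1"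
    and z: "norm z < 1" and qz: "q z = 0" "deriv q z = 0"
    and bound: "\<And>w. norm w < 1 \<Longrightarrow> norm (p w + cnj (q w)) < 1"
  shows "norm (deriv p z) \<le> (1 - (norm (p z))\<^sup>2) / (1 - (norm z)\<^sup>2)"
    and "norm (deriv p z) = (1 - (norm (p z))\<^sup>2) / (1 - (norm z)\<^sup>2) \<Longrightarrow>
      bij_betw p (ball 0 1) (ball 0 1) \<and> (\<forall>w\<in>ball 0 1. q w = 0)"
proof -
  define M where "M = Moebius_function 0 (- z)"
  define N where "N = Moebius_function 0 z"
  have M0: "M 0 = z"
    by (simp add: M_def Moebius_function_of_zero)
  have M: "M holomorphic_on ball 0 1" "norm (M w) < 1" if "norm w < 1" for w
    using that z by (auto simp: M_def Moebius_function_holomorphic Moebius_function_norm_lt_1)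
  have N: "norm (N w) < 1" "M (N w) = w" if "norm w < 1" for w
    using that z by (auto simp: M_def N_def Moebius_function_compose Moebius_function_norm_lt_1)
  have Msub: "M ` ball 0 1 \<subseteq> ball 0 1"
    using M(2) by auto
  have Mhol: "M holomorphic_on ball 0 1"
    using M(1)[of 0] by simp
  have hol: "(\<lambda>w. g (M w)) holomorphic_on ball 0 1" if "g holomorphic_on ball 0 1" for g
    using holomorphic_on_compose_gen[OF Mhol that Msub] by (simp add: comp_def)
  have der: "deriv (\<lambda>w. g (M w)) 0 = deriv g z * of_real (1 - (norm z)\<^sup>2)"
    if "g holomorphic_on ball 0 1" for g
  proof -
    have "(g has_field_derivative deriv g z) (at (M 0))"
      using holomorphic_derivI[OF that, of z] z by (simp add: M0)
    from DERIV_chain2[OF this DERIV_Moebius_at_zero[of z, folded M_def]] show ?thesis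
      by (rule DERIV_imp_deriv)
  qed
  have sq: "1 - (norm z)\<^sup>2 > 0"
    using z by (simp add: abs_square_less_1)
  have nd: "norm (deriv (\<lambda>w. p (M w)) 0) = norm (deriv p z) * (1 - (norm z)\<^sup>2)"
    unfolding der[OF p] norm_mult norm_of_real using sq by simp
  have bd: "norm (p (M w) + cnj (q (M w))) < 1" if "norm w < 1" for w
    by (rule bound[OF M(2)[OF that]])
  have q0: "q (M 0) = 0" "deriv (\<lambda>w. q (M w)) 0 = 0"
    unfolding der[OF q] M0 using qz by simp_all
  note O = conformal_schwarz_origin[OF hol[OF p] hol[OF q] q0 bd]
  show "norm (deriv p z) \<le> (1 - (norm (p z))\<^sup>2) / (1 - (norm z)\<^sup>2)"
    using O(1) sq unfolding nd M0 by (simp add: pos_le_divide_eq)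
  assume "norm (deriv p z) = (1 - (norm (p z))\<^sup>2) / (1 - (norm z)\<^sup>2)"
  then have "norm (deriv (\<lambda>w. p (M w)) 0) = 1 - (norm (p (M 0)))\<^sup>2"
    unfolding nd M0 using sq by simp
  from O(2)[OF _ this] obtain k b where kb: "norm k = 1" "norm b < 1"
    and eq: "\<And>w. norm w < 1 \<Longrightarrow> q (M w) = 0 \<and> p (M w) = k * Moebius_function 0 b w"
    by blast
  have w: "q w = 0 \<and> k * Moebius_function 0 b (N w) = p w" if "w \<in> ball 0 1" for w
    using eq[of "N w"] N[of w] that by simp
  have "bij_betw N (ball 0 1) (ball 0 1)"
    using bij_betw_Moebius[of 1 z] z by (simp add: N_def)
  from bij_betw_trans[OF this bij_betw_Moebius[OF kb]]
  have "bij_betw (\<lambda>w. k * Moebius_function 0 b (N w)) (ball 0 1) (ball 0 1)"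
    by (simp add: comp_def)
  then have "bij_betw p (ball 0 1) (ball 0 1)"
    using bij_betw_cong[of "ball 0 1" "\<lambda>w. k * Moebius_function 0 b (N w)" p "ball 0 1"] w by blast
  then show "bij_betw p (ball 0 1) (ball 0 1) \<and> (\<forall>w\<in>ball 0 1. q w = 0)"
    using w by blast
qed

text \<open>
  The inequality for \<open>f\<close> at \<open>z\<close> and for its inverse at \<open>f z\<close> have bounds with product \<open>1\<close>, and so do
  the two derivatives; hence neither inequality can be strict.
\<close>

lemma disc_automorphism_norm_deriv:
  assumes f: "f holomorphic_on ball 0 1" "bij_betw f (ball 0 1) (ball 0 1)" and z: "z \<in> ball 0 1"
  shows "norm (deriv f z) = (1 - (norm (f z))\<^sup>2) / (1 - (norm z)\<^sup>2)"
proof -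
  have inj: "inj_on f (ball 0 1)" and im: "f ` ball 0 1 = ball 0 1"
    using f(2) by (auto simp: bij_betw_def)
  obtain g where g: "g holomorphic_on (f ` ball 0 1)"
    and dg: "\<And>w. w \<in> ball 0 1 \<Longrightarrow> deriv f w * deriv g (f w) = 1"
    and gf: "\<And>w. w \<in> ball 0 1 \<Longrightarrow> g (f w) = w"
    using holomorphic_has_inverse[OF f(1) open_ball inj] by metis
  have le: "norm (deriv h w) \<le> (1 - (norm (h w))\<^sup>2) / (1 - (norm w)\<^sup>2)"
    if "h holomorphic_on ball 0 1" "h ` ball 0 1 \<subseteq> ball 0 1" "w \<in> ball 0 1" for h w
    using conformal_schwarz_pick(1)[OF that(1), of "\<lambda>_. 0" w] that by (auto simp: image_subset_iff)
  have fz: "f z \<in> ball 0 1"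
    using im z by blast
  have "g ` f ` ball 0 1 \<subseteq> ball 0 1"
    using gf by auto
  then have "g ` ball 0 1 \<subseteq> ball 0 1"
    by (simp only: im)
  then have lg: "norm (deriv g (f z)) \<le> (1 - (norm z)\<^sup>2) / (1 - (norm (f z))\<^sup>2)"
    using le[of g "f z"] g fz by (simp add: im gf[OF z])
  have sq: "1 - (norm z)\<^sup>2 > 0" "1 - (norm (f z))\<^sup>2 > 0"
    using z fz by (auto simp: abs_square_less_1)
  have "norm (deriv f z) * norm (deriv g (f z)) = 1"
    using dg[OF z] by (metis norm_mult norm_one)
  then have "1 \<le> norm (deriv f z) * ((1 - (norm z)\<^sup>2) / (1 - (norm (f z))\<^sup>2))"
    using mult_left_mono[OF lg, of "norm (deriv f z)"] by simp
  then have "(1 - (norm (f z))\<^sup>2) / (1 - (norm z)\<^sup>2) \<le> norm (deriv f z)"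
    using sq by (simp add: field_simps)
  then show ?thesis
    using le[OF f(1) _ z] im by simp
qed


section \<open>Harmonic maps that are conformal at a point\<close>

lemma bij_betw_cnj_disc: "bij_betw cnj (ball 0 1) (ball 0 1)"
  by (rule bij_betw_byWitness[where f' = cnj]) auto

text \<open>
  The right-hand side of the equivalence is left unchanged by conjugating \<open>f\<close>, so that the
  orientation-reversing case follows by exchanging \<open>p\<close> and \<open>q\<close>.
\<close>

lemma schwarz_pick_orientation_preserving:
  assumes p: "p holomorphic_on ball 0 1" and q: "q holomorphic_on ball 0 1"
    and z: "z \<in> ball 0 1" and qz: "deriv q z = 0"
    and f: "\<And>w. w \<in> ball 0 1 \<Longrightarrow> f w = p w + cnj (q w)" and im: "f ` ball 0 1 \<subseteq> ball 0 1"
  shows "norm (deriv p z) \<le> (1 - (norm (f z))\<^sup>2) / (1 - (norm z)\<^sup>2)"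
    and "norm (deriv p z) = (1 - (norm (f z))\<^sup>2) / (1 - (norm z)\<^sup>2) \<longleftrightarrow>
      bij_betw f (ball 0 1) (ball 0 1) \<and>
        (f holomorphic_on ball 0 1 \<or> (\<lambda>w. cnj (f w)) holomorphic_on ball 0 1)"
proof -
  define P where "P = (\<lambda>w. p w + cnj (q z))"
  define Q where "Q = (\<lambda>w. q w - q z)"
  have hol: "P holomorphic_on ball 0 1" "Q holomorphic_on ball 0 1"
    unfolding P_def Q_def using p q by (auto intro!: holomorphic_intros)
  have fPQ: "f w = P w + cnj (Q w)" if "w \<in> ball 0 1" for w
    using f[OF that] by (simp add: P_def Q_def)
  have dp: "(p has_field_derivative deriv p z) (at z)" "(q has_field_derivative 0) (at z)"
    using holomorphic_derivI[OF p _ z] holomorphic_derivI[OF q _ z] qz by auto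
  have dP: "deriv P z = deriv p z" "deriv Q z = 0"
    unfolding P_def Q_def using dp by (auto intro!: DERIV_imp_deriv derivative_eq_intros)
  have Qz: "Q z = 0" and Pz: "P z = f z"
    using fPQ[OF z] by (simp_all add: Q_def)
  have bound: "norm (P w + cnj (Q w)) < 1" if "norm w < 1" for w
    using im fPQ[of w] that by (metis image_subset_iff mem_ball_0)
  have nz: "norm z < 1"
    using z by simp
  note SP = conformal_schwarz_pick[OF hol nz Qz dP(2) bound, unfolded dP Pz]
  show "norm (deriv p z) \<le> (1 - (norm (f z))\<^sup>2) / (1 - (norm z)\<^sup>2)"
    by (rule SP(1))
  have D: "(f has_derivative (\<lambda>w. deriv p z * w)) (at z)"
  proof (rule has_derivative_transform_within_open[OF _ open_ball z])
    show "((\<lambda>w. p w + cnj (q w)) has_derivative (\<lambda>w. deriv p z * w)) (at z)"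
      using has_derivative_add[OF dp(1)[unfolded has_field_derivative_def]
          has_derivative_cnj[OF dp(2)[unfolded has_field_derivative_def]]] by simp
  qed (use f in simp)
  show "norm (deriv p z) = (1 - (norm (f z))\<^sup>2) / (1 - (norm z)\<^sup>2) \<longleftrightarrow>
      bij_betw f (ball 0 1) (ball 0 1) \<and>
        (f holomorphic_on ball 0 1 \<or> (\<lambda>w. cnj (f w)) holomorphic_on ball 0 1)"
    (is "?L \<longleftrightarrow> ?R")
  proof
    assume ?L
    from SP(2)[OF _ this] have bij: "bij_betw P (ball 0 1) (ball 0 1)"
      and eq: "\<And>w. w \<in> ball 0 1 \<Longrightarrow> P w = f w"
      using fPQ by auto
    have "f holomorphic_on ball 0 1"
      using holomorphic_cong[of "ball 0 1" "ball 0 1" P f] eq hol(1) by blast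
    moreover have "bij_betw f (ball 0 1) (ball 0 1)"
      using bij_betw_cong[of "ball 0 1" P f "ball 0 1"] eq bij by blast
    ultimately show ?R
      by blast
  next
    assume ?R
    then consider "f holomorphic_on ball 0 1" "bij_betw f (ball 0 1) (ball 0 1)"
      | "(\<lambda>w. cnj (f w)) holomorphic_on ball 0 1" "bij_betw f (ball 0 1) (ball 0 1)"
      by blast
    then show ?L
    proof cases
      case 1
      have "(*) (deriv f z) = (\<lambda>w. deriv p z * w)"
        using has_derivative_unique[OF _ D] holomorphic_derivI[OF 1(1) open_ball z]
        by (simp add: has_field_derivative_def)
      then have "deriv f z = deriv p z"
        by (metis mult.right_neutral)
      then show ?thesis
        using disc_automorphism_norm_deriv[OF 1 z] by simp
    next
      case 2
      let ?h = "\<lambda>w. cnj (f w)"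
      from bij_betw_trans[OF 2(2) bij_betw_cnj_disc] have "bij_betw ?h (ball 0 1) (ball 0 1)"
        by (simp add: comp_def)
      note N = disc_automorphism_norm_deriv[OF 2(1) this z]
      \<comment> \<open>Comparing the two forms of the differential of \<open>cnj f\<close> in the direction \<open>1\<close> suffices.\<close>
      have "(*) (deriv ?h z) = (\<lambda>w. cnj (deriv p z * w))"
        using has_derivative_unique[OF _ has_derivative_cnj[OF D]]
          holomorphic_derivI[OF 2(1) open_ball z]
        by (simp add: has_field_derivative_def)
      then have "deriv ?h z * 1 = cnj (deriv p z * 1)"
        by (rule fun_cong)
      then show ?thesis
        using N by simp
    qed
  qed
qed

lemma onorm_similarity:
  fixes L :: "complex \<Rightarrow> complex"
  assumes "bounded_linear L" "\<And>w. norm (L w) = N * norm w"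
  shows "onorm L = N"
proof (rule antisym)
  have "0 \<le> N"
    using assms(2)[of 1] norm_ge_zero[of "L 1"] by simp
  then show "onorm L \<le> N"
    using assms(2) by (intro onorm_bound) auto
  show "N \<le> onorm L"
    using onorm[OF assms(1), of 1] assms(2)[of 1] by simp
qed

theorem theorem1p1:
  fixes f :: "complex \<Rightarrow> complex" and z :: complex
  assumes "harmonic_map_on (ball 0 1) f"
    and "f ` ball 0 1 \<subseteq> ball 0 1"
    and "z \<in> ball 0 1"
    and "conformal_at f z"
  shows "onorm (frechet_derivative f (at z)) \<le> (1 - (norm (f z))\<^sup>2) / (1 - (norm z)\<^sup>2) \<and>
    (onorm (frechet_derivative f (at z)) = (1 - (norm (f z))\<^sup>2) / (1 - (norm z)\<^sup>2) \<longleftrightarrow>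
      conformal_diffeomorphism (ball 0 1) (ball 0 1) f)"
proof -
  obtain p q where p: "p holomorphic_on ball 0 1" and q: "q holomorphic_on ball 0 1"
    and f: "\<And>w. w \<in> ball 0 1 \<Longrightarrow> f w = p w + cnj (q w)"
    using harmonic_map_decomposition[OF open_ball convex_ball assms(1)] by metis
  define a where "a = deriv p z"
  define b where "b = deriv q z"
  have "(p has_derivative (*) a) (at z)" "(q has_derivative (*) b) (at z)"
    using holomorphic_derivI[OF p open_ball assms(3)] holomorphic_derivI[OF q open_ball assms(3)]
    by (simp_all add: has_field_derivative_def a_def b_def)
  then have "((\<lambda>w. p w + cnj (q w)) has_derivative (\<lambda>w. a * w + cnj (b * w))) (at z)"
    by (intro has_derivative_add has_derivative_cnj)
  then have D: "(f has_derivative (\<lambda>w. a * w + cnj (b * w))) (at z)"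
    by (rule has_derivative_transform_within_open[OF _ open_ball assms(3)]) (simp add: f)
  have iff: "conformal_diffeomorphism (ball 0 1) (ball 0 1) f \<longleftrightarrow>
      bij_betw f (ball 0 1) (ball 0 1) \<and>
        (f holomorphic_on ball 0 1 \<or> (\<lambda>w. cnj (f w)) holomorphic_on ball 0 1)"
    using conformal_diffeomorphism_iff[OF open_ball connected_ball, of 0 1 "ball 0 1" f] by simp
  \<comment> \<open>In terms of \<open>a\<close> and \<open>cnj b\<close>, which are \<open>f\<^sub>z\<close> and the derivative of \<open>f\<close> in \<open>cnj z\<close>, conformality
    makes \<open>f\<^sub>y\<close> equal to \<open>\<i> f\<^sub>x\<close> or to its negative.\<close>
  have "a * cnj b = 0"
  proof -
    have "partial_x f z = a + cnj b" "partial_y f z = \<i> * a - \<i> * cnj b"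
      using partial_has_derivative[OF D] by (simp_all add: mult.commute)
    then have "\<i> * a - \<i> * cnj b = \<i> * (a + cnj b) \<or> \<i> * a - \<i> * cnj b = - \<i> * (a + cnj b)"
      using assms(4) orthogonal_complex unfolding conformal_at_def by metis
    then show ?thesis
      by (auto simp: algebra_simps)
  qed
  then consider "b = 0" | "a = 0"
    by auto
  then show ?thesis
  proof cases
    case 1
    have "onorm (frechet_derivative f (at z)) = norm a"
      unfolding frechet_derivative_at[OF D, symmetric]
      by (rule onorm_similarity[OF has_derivative_bounded_linear[OF D]]) (simp add: 1 norm_mult)
    then show ?thesis
      unfolding iff using schwarz_pick_orientation_preserving[OF p q assms(3) _ f assms(2)] 1
      by (simp add: a_def b_def)
  next
    case 2
    let ?h = "\<lambda>w. cnj (f w)"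
    have "onorm (frechet_derivative f (at z)) = norm b"
      unfolding frechet_derivative_at[OF D, symmetric]
      by (rule onorm_similarity[OF has_derivative_bounded_linear[OF D]]) (simp add: 2 norm_mult)
    moreover have h: "?h w = q w + cnj (p w)" if "w \<in> ball 0 1" for w
      using f[OF that] by simp
    moreover have im: "?h ` ball 0 1 \<subseteq> ball 0 1"
      using assms(2) by auto
    moreover have "bij_betw ?h (ball 0 1) (ball 0 1) \<longleftrightarrow> bij_betw f (ball 0 1) (ball 0 1)"
    proof -
      from bij_betw_trans[OF _ bij_betw_cnj_disc, of ?h "ball 0 1"]
        bij_betw_trans[OF _ bij_betw_cnj_disc, of f "ball 0 1"]
      show ?thesis
        by (auto simp: comp_def)
    qed
    ultimately show ?thesis
      unfolding iff using schwarz_pick_orientation_preserving[OF q p assms(3) _ h im] 2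
      by (auto simp: a_def b_def)
  qed
qed

end
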